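(* Let $a_0,\dots,a_N$ be constants and put $P_x(w)=\sum_{k=0}^{N}a_k w^k$, where $P_x(-n)\neq 0$ for every integer $n\ge 1$. Let $(C(n))_{n\ge 1}$ be a sequence of numbers. If $$\sum_{\nu=0}^{N}a_\nu u^{(\nu)}(x)=\sum_{n=1}^{\infty}\frac{C(n)}{e^{nx}-1}\qquad (x>0),$$ then $$u(x)=\sum_{n=1}^{\infty}\frac{\sum_{d\mid n}C(d)}{P_x(-n)}e^{-nx}.$$
   Context: $\sum_{d\mid n}$ is the sum over the positive divisors $d$ of $n$, and $u^{(\nu)}$ is the $\nu$-th derivative of $u$. The subscript $x$ in $P_x$ is only a label.
   Formalization: The claim fails for general u (homogeneous solutions can be added); proved instead: the series converges and solves the equation, every solution is the series plus a homogeneous solution, and equality holds for every u that is a convergent series in e^{-nx}, n ≥ 1, on x>0. *)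

theory Defs
  imports "HOL-Analysis.Analysis"
begin

definition char_fun :: "(nat \<Rightarrow> complex) \<Rightarrow> nat \<Rightarrow> complex \<Rightarrow> complex" where
  "char_fun a N w = (\<Sum>k\<le>N. a k * w ^ k)"

definition nth_deriv :: "nat \<Rightarrow> (real \<Rightarrow> complex) \<Rightarrow> real \<Rightarrow> complex" where
  "nth_deriv k u = ((\<lambda>g x. vector_derivative g (at x)) ^^ k) u"

text \<open>
  Since \<^const>\<open>vector_derivative\<close> is total, existence of the derivatives up to order \<open>N\<close>
  is required explicitly. Values of \<open>u\<close> outside the open half-line play no role.
\<close>

definition solves_ode ::
  "(nat \<Rightarrow> complex) \<Rightarrow> nat \<Rightarrow> (real \<Rightarrow> complex) \<Rightarrow> (real \<Rightarrow> complex) \<Rightarrow> bool" where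
  "solves_ode a N f u \<longleftrightarrow>
     (\<forall>\<nu><N. \<forall>x>0. nth_deriv \<nu> u differentiable (at x)) \<and>
     (\<forall>x>0. (\<Sum>\<nu>\<le>N. a \<nu> * nth_deriv \<nu> u x) = f x)"

text \<open>
  Sequences indexed by \<open>n \<ge> 1\<close> are functions on \<^typ>\<open>nat\<close> whose value at \<open>0\<close> is never used;
  the summation index is shifted accordingly.
\<close>

definition lambert_term :: "(nat \<Rightarrow> complex) \<Rightarrow> real \<Rightarrow> nat \<Rightarrow> complex" where
  "lambert_term C x n = C n / (of_real (exp (real n * x)) - 1)"

definition exp_term :: "(nat \<Rightarrow> complex) \<Rightarrow> real \<Rightarrow> nat \<Rightarrow> complex" where
  "exp_term b x n = b n * of_real (exp (- (real n * x)))"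

definition sol_coeff :: "(nat \<Rightarrow> complex) \<Rightarrow> nat \<Rightarrow> (nat \<Rightarrow> complex) \<Rightarrow> nat \<Rightarrow> complex" where
  "sol_coeff a N C n = (\<Sum>d | d dvd n. C d) / char_fun a N (- of_nat n)"

end

theory Submission
  imports Defs "HOL-Complex_Analysis.Cauchy_Integral_Formula"
begin

text \<open>
  With \<open>q = exp (- x)\<close> every series in \<open>exp (- (n * x))\<close> is a power series in \<open>q\<close> without constant
  term that converges on the unit disc, so it may be differentiated termwise; the differential
  operator multiplies its \<open>n\<close>-th coefficient by \<open>P (- n)\<close>. Expanding the Lambert series
  geometrically turns the right-hand side into such a series with the divisor sums as coefficients,
  and uniqueness of power series coefficients determines the solution. The new series
  converges because \<open>1 / P (- n)\<close> is bounded.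
\<close>

section \<open>Exponential series as power series in \<open>exp (- x)\<close>\<close>

lemma exp_term_powser:
  "exp_term c x n = c n * of_real (exp (- x)) ^ n"
  using exp_of_nat_mult[of n "- x"] by (simp add: exp_term_def)

text \<open>The value \<open>c 0\<close> is arbitrary, so it is overwritten by 0; the shifted series
  then becomes a full power series at \<open>exp (- x)\<close>, open to power series theory.\<close>

lemma exp_term_sums_iff:
  "(\<lambda>n. exp_term c x (Suc n)) sums s \<longleftrightarrow> (\<lambda>n. (c(0 := 0)) n * of_real (exp (- x)) ^ n) sums s"
proof -
  have "(\<lambda>n. exp_term c x (Suc n)) = (\<lambda>n. (c(0 := 0)) (Suc n) * of_real (exp (- x)) ^ Suc n)"
    by (simp add: exp_term_powser fun_eq_iff)
  then show ?thesis
    using sums_Suc_iff[of "\<lambda>n. (c(0 := 0)) n * of_real (exp (- x)) ^ n" s] by simp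
qed

lemma suminf_exp_term:
  "(\<Sum>n. exp_term c x (Suc n)) = (\<Sum>n. (c(0 := 0)) n * of_real (exp (- x)) ^ n)"
  \<comment> \<open>Both values of \<open>suminf\<close> are defined through equivalent
    \<open>sums\<close> predicates, so the equality covers divergent series as well.\<close>
  unfolding suminf_def exp_term_sums_iff[abs_def] ..

text \<open>The points \<open>exp (- x)\<close> with \<open>x > 0\<close> fill the interval (0, 1).
  Some such point \<open>r\<close> exceeds \<open>norm z\<close>, and a power series converging at
  \<open>r\<close> converges absolutely at every point of smaller modulus.\<close>

lemma summable_norm_disc:
  assumes "\<And>x. x > 0 \<Longrightarrow> summable (\<lambda>n. exp_term c x (Suc n))" and "norm z < 1"
  shows "summable (\<lambda>n. norm ((c(0 := 0)) n * z ^ n))"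
proof -
  obtain r where r: "norm z < r" "r < 1" using dense[OF assms(2)] by blast
  then have "r > 0" using norm_ge_zero[of z] by linarith
  then have q: "exp (- (- ln r)) = r" and "- ln r > 0" using r by auto
  then have "summable (\<lambda>n. exp_term c (- ln r) (Suc n))" using assms(1) by blast
  then have "summable (\<lambda>n. (c(0 := 0)) n * complex_of_real r ^ n)"
    unfolding summable_def exp_term_sums_iff q .
  then show ?thesis
    using r \<open>r > 0\<close> by (intro powser_insidea[of _ "of_real r"]) auto
qed

lemma summable_exp_term_derivative:
  assumes "\<And>x. x > 0 \<Longrightarrow> summable (\<lambda>n. exp_term c x (Suc n))" and "x > 0"
  shows "summable (\<lambda>n. exp_term (\<lambda>n. - of_nat n * c n) x (Suc n))"
proof -
  have "summable (\<lambda>n. diffs (c(0 := 0)) n * complex_of_real (exp (- x)) ^ n)"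
    using assms(2) summable_norm_cancel[OF summable_norm_disc[OF assms(1)]]
    by (intro termdiff_converges[of _ 1]) auto
  then have "summable (\<lambda>n. - of_real (exp (- x)) *
      (diffs (c(0 := 0)) n * complex_of_real (exp (- x)) ^ n))"
    by (rule summable_mult)
  moreover have "(\<lambda>n. exp_term (\<lambda>n. - of_nat n * c n) x (Suc n)) = (\<lambda>n. - of_real (exp (- x)) *
      (diffs (c(0 := 0)) n * complex_of_real (exp (- x)) ^ n))"
    by (simp add: exp_term_powser fun_eq_iff diffs_def)
  ultimately show ?thesis by simp
qed

text \<open>Chain rule through \<open>exp (- y)\<close>, whose derivative at \<open>x\<close> is
  \<open>- q\<close>: this factor restores the power of \<open>q\<close> lost in termwise
  differentiation, so the result is again an exponential series.\<close>

lemma exp_series_has_vector_derivative: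
  assumes "\<And>x. x > 0 \<Longrightarrow> summable (\<lambda>n. exp_term c x (Suc n))" and "x > 0"
  shows "((\<lambda>x. \<Sum>n. exp_term c x (Suc n)) has_vector_derivative
    (\<Sum>n. exp_term (\<lambda>n. - of_nat n * c n) x (Suc n))) (at x)"
proof -
  define q where "q = complex_of_real (exp (- x))"
  have q: "norm q < 1" using assms(2) by (simp add: q_def)
  have sm: "\<And>z. norm z < 1 \<Longrightarrow> summable (\<lambda>n. (c(0 := 0)) n * z ^ n)"
    by (rule summable_norm_cancel[OF summable_norm_disc[OF assms(1)]])
  have "((\<lambda>z. \<Sum>n. (c(0 := 0)) n * z ^ n) has_field_derivative (\<Sum>n. diffs (c(0 := 0)) n * q ^ n)) (at q)"
    by (rule termdiffs_strong'[OF sm q])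
  moreover have "((\<lambda>y. complex_of_real (exp (- y))) has_vector_derivative - q) (at x)"
    unfolding q_def by (auto intro!: derivative_eq_intros)
  ultimately have "((\<lambda>z. \<Sum>n. (c(0 := 0)) n * z ^ n) \<circ> (\<lambda>y. complex_of_real (exp (- y)))
      has_vector_derivative - q * (\<Sum>n. diffs (c(0 := 0)) n * q ^ n)) (at x)"
    by (intro field_vector_diff_chain_at) (simp_all add: q_def)
  moreover have "- q * (\<Sum>n. diffs (c(0 := 0)) n * q ^ n)
      = (\<Sum>n. exp_term (\<lambda>n. - of_nat n * c n) x (Suc n))"
  proof -
    have "- q * (\<Sum>n. diffs (c(0 := 0)) n * q ^ n) = (\<Sum>n. - q * (diffs (c(0 := 0)) n * q ^ n))"
      by (rule suminf_mult[symmetric]) (rule termdiff_converges[OF q sm])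
    also have "\<dots> = (\<Sum>n. exp_term (\<lambda>n. - of_nat n * c n) x (Suc n))"
      by (simp add: exp_term_powser diffs_def q_def mult_ac)
    finally show ?thesis .
  qed
  ultimately show ?thesis by (simp add: suminf_exp_term o_def)
qed

section \<open>Higher derivatives of exponential series\<close>

lemma nth_deriv_0 [simp]: "nth_deriv 0 u = u"
  by (simp add: nth_deriv_def)

lemma nth_deriv_Suc: "nth_deriv (Suc k) u x = vector_derivative (nth_deriv k u) (at x)"
  by (simp add: nth_deriv_def)

text \<open>Induction on the order. \<open>u\<close> is known to agree with the series only for
  positive arguments; this set is open, so derivatives can be transferred there, provided the
  equality of order \<open>k\<close> is available on the whole half-line.\<close>

lemma nth_deriv_exp_series:
  assumes "\<And>x. x > 0 \<Longrightarrow> summable (\<lambda>n. exp_term c x (Suc n))"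
    and "\<And>x. x > 0 \<Longrightarrow> u x = (\<Sum>n. exp_term c x (Suc n))"
    and "x > 0"
  shows "nth_deriv k u x = (\<Sum>n. exp_term (\<lambda>n. (- of_nat n) ^ k * c n) x (Suc n))"
    and "summable (\<lambda>n. exp_term (\<lambda>n. (- of_nat n) ^ k * c n) x (Suc n))"
    and "nth_deriv k u differentiable (at x)"
proof -
  have sm: "summable (\<lambda>n. exp_term (\<lambda>n. (- of_nat n) ^ k * c n) x (Suc n))" if "x > 0" for k x
    using that
  proof (induction k arbitrary: x)
    case (Suc k)
    then show ?case
      using summable_exp_term_derivative[of "\<lambda>n. (- of_nat n) ^ k * c n" x] by (simp add: mult.assoc)
  qed (simp add: assms(1))
  have step: "(nth_deriv k u has_vector_derivative
      (\<Sum>n. exp_term (\<lambda>n. (- of_nat n) ^ Suc k * c n) x (Suc n))) (at x)"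
    if "\<And>x. x > 0 \<Longrightarrow> nth_deriv k u x = (\<Sum>n. exp_term (\<lambda>n. (- of_nat n) ^ k * c n) x (Suc n))" "x > 0"
    for k x
  proof (rule has_vector_derivative_transform_within_open[where S = "{0<..}"])
    show "((\<lambda>x. \<Sum>n. exp_term (\<lambda>n. (- of_nat n) ^ k * c n) x (Suc n)) has_vector_derivative
        (\<Sum>n. exp_term (\<lambda>n. (- of_nat n) ^ Suc k * c n) x (Suc n))) (at x)"
      unfolding power_Suc mult.assoc
      by (rule exp_series_has_vector_derivative[OF sm \<open>x > 0\<close>])
  qed (use that in auto)
  have eq: "nth_deriv k u x = (\<Sum>n. exp_term (\<lambda>n. (- of_nat n) ^ k * c n) x (Suc n))" if "x > 0" for k x
    using that
  proof (induction k arbitrary: x)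
    case (Suc k)
    then show ?case
      using vector_derivative_at[OF step[of k x]] by (simp add: nth_deriv_Suc)
  qed (simp add: assms(2))
  show "nth_deriv k u x = (\<Sum>n. exp_term (\<lambda>n. (- of_nat n) ^ k * c n) x (Suc n))"
    "summable (\<lambda>n. exp_term (\<lambda>n. (- of_nat n) ^ k * c n) x (Suc n))"
    using eq sm \<open>x > 0\<close> by blast+
  show "nth_deriv k u differentiable (at x)"
    using step[OF eq \<open>x > 0\<close>] by (blast intro: differentiableI_vector)
qed

lemma ode_operator_exp_series:
  assumes "\<And>x. x > 0 \<Longrightarrow> summable (\<lambda>n. exp_term c x (Suc n))"
    and "\<And>x. x > 0 \<Longrightarrow> u x = (\<Sum>n. exp_term c x (Suc n))"
    and "x > 0"
  shows "(\<lambda>n. exp_term (\<lambda>n. char_fun a N (- of_nat n) * c n) x (Suc n))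
    sums (\<Sum>\<nu>\<le>N. a \<nu> * nth_deriv \<nu> u x)"
proof -
  have "(\<lambda>n. \<Sum>\<nu>\<le>N. a \<nu> * exp_term (\<lambda>n. (- of_nat n) ^ \<nu> * c n) x (Suc n))
      sums (\<Sum>\<nu>\<le>N. a \<nu> * nth_deriv \<nu> u x)"
    using nth_deriv_exp_series[OF assms]
    by (intro sums_sum sums_mult) (auto intro: summable_sums)
  moreover have "(\<lambda>n. \<Sum>\<nu>\<le>N. a \<nu> * exp_term (\<lambda>n. (- of_nat n) ^ \<nu> * c n) x (Suc n))
      = (\<lambda>n. exp_term (\<lambda>n. char_fun a N (- of_nat n) * c n) x (Suc n))"
    by (simp add: exp_term_def char_fun_def sum_distrib_right sum_distrib_left fun_eq_iff mult.assoc)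
  ultimately show ?thesis by simp
qed

section \<open>Uniqueness of coefficients\<close>

text \<open>Zeros of a nonzero power series are isolated, whereas the difference of the two series
  vanishes on all of (0, 1), which accumulates at the centre.\<close>

lemma exp_series_coeff_unique:
  assumes "\<And>x. x > 0 \<Longrightarrow> (\<lambda>n. exp_term c x (Suc n)) sums s x"
    and "\<And>x. x > 0 \<Longrightarrow> (\<lambda>n. exp_term d x (Suc n)) sums s x"
    and "m > 0"
  shows "c m = d m"
proof (rule ccontr)
  assume ne: "c m \<noteq> d m"
  \<comment> \<open>The value 0 at index 0 makes \<open>b(0 := 0)\<close> equal to \<open>b\<close>
    and makes the power series vanish at its centre, as \<open>powser_0_nonzero\<close>
    requires.\<close>
  define b where "b n = (if n = 0 then 0 else c n - d n)" for n
  have "(\<lambda>n. exp_term b x (Suc n)) sums 0" if "x > 0" for x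
    using sums_diff[OF assms(1)[OF that] assms(2)[OF that]]
    by (simp add: exp_term_def b_def algebra_simps)
  moreover have b0: "b(0 := 0) = b" by (auto simp: b_def)
  ultimately have zero: "(\<lambda>n. b n * of_real (exp (- x)) ^ n) sums 0" if "x > 0" for x
    using that by (simp add: exp_term_sums_iff)
  have sm: "summable (\<lambda>n. b n * z ^ n)" if "norm z < 1" for z
    using summable_norm_cancel[OF summable_norm_disc[of b z]] that zero
    by (auto simp: summable_def exp_term_sums_iff b0)
  obtain s where s: "0 < s"
    "\<And>z. z \<in> cball 0 s - {0} \<Longrightarrow> (\<Sum>n. b n * z ^ n) \<noteq> 0"
  proof (rule powser_0_nonzero[of 1 0 b "\<lambda>z. \<Sum>n. b n * z ^ n" m])
    show "(\<lambda>n. b n * (x - 0) ^ n) sums (\<Sum>n. b n * x ^ n)" if "norm (x - 0) < 1" for x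
      using sm that by (auto intro: summable_sums)
    show "(\<Sum>n. b n * 0 ^ n) = 0"
      by (simp add: b_def)
    show "b m \<noteq> 0" using ne \<open>m > 0\<close> by (simp add: b_def)
  qed (use \<open>m > 0\<close> in auto)
  \<comment> \<open>A nonzero point of the ball on which the series has no zero but the centre;
    being below 1, it equals \<open>exp (- x)\<close> for \<open>x = - ln r > 0\<close>.\<close>
  define r where "r = min s (1/2)"
  have r: "0 < r" "r \<le> s" "r < 1" using s(1) by (auto simp: r_def)
  then have "(\<lambda>n. b n * complex_of_real r ^ n) sums 0"
    using zero[of "- ln r"] by simp
  then show False
    using s(2)[of "of_real r"] r by (auto simp: sums_iff)
qed

section \<open>Boundedness of the inverse characteristic values\<close>

text \<open>A nonconstant polynomial has modulus at least 1 outside some disc, which leaves finitely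
  many \<open>n\<close>. If all coefficients of positive degree vanish, the values are constantly
  \<open>a 0\<close>.\<close>

lemma char_fun_inverse_bounded:
  assumes "\<And>n. n \<ge> 1 \<Longrightarrow> char_fun a N (- of_nat n) \<noteq> 0"
  obtains K where "\<And>n. n \<ge> 1 \<Longrightarrow> norm (inverse (char_fun a N (- of_nat n))) \<le> K"
proof (cases "\<exists>k. 1 \<le> k \<and> k \<le> N \<and> a k \<noteq> 0")
  case True
  then obtain k where "a k \<noteq> 0" "1 \<le> k" "k \<le> N" by blast
  then have "eventually (\<lambda>z. 1 \<le> norm (char_fun a N z)) at_infinity"
    unfolding char_fun_def by (rule Limits.polyfun_extremal)
  then obtain B where B: "\<And>z. B \<le> norm z \<Longrightarrow> 1 \<le> norm (char_fun a N z)"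
    unfolding eventually_at_infinity by blast
  obtain M :: nat where "B \<le> real M" using real_arch_simple by blast
  then have M: "norm (inverse (char_fun a N (- of_nat n))) \<le> 1" if "n \<ge> M" for n
    using B[of "- of_nat n"] that by (simp add: norm_inverse inverse_le_1_iff)
  \<comment> \<open>The 1 covers all indices from \<open>M\<close> on; each of the finitely many
    others is dominated by the whole sum.\<close>
  define K where "K = 1 + (\<Sum>n<M. norm (inverse (char_fun a N (- of_nat n))))"
  have "norm (inverse (char_fun a N (- of_nat n))) \<le> K" for n
  proof (cases "n < M")
    case True
    then have "norm (inverse (char_fun a N (- of_nat n)))
        \<le> (\<Sum>n<M. norm (inverse (char_fun a N (- of_nat n))))"
      by (intro member_le_sum) auto
    then show ?thesis by (simp add: K_def)
  next
    case False
    then have "norm (inverse (char_fun a N (- of_nat n))) \<le> 1" using M by simp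
    also have "1 \<le> K" unfolding K_def by (simp add: sum_nonneg)
    finally show ?thesis .
  qed
  then show ?thesis using that by blast
next
  case False
  then have "char_fun a N z = a 0" for z
    unfolding char_fun_def
    by (subst sum.mono_neutral_right[of _ "{0}"]) (auto simp: Suc_le_eq)
  then show ?thesis using that[of "norm (inverse (a 0))"] by simp
qed

section \<open>Lambert series\<close>

text \<open>
  Convergence at \<open>x / 2\<close> bounds the terms there, and passing from \<open>x / 2\<close> to \<open>x\<close> gains a
  geometric factor.
\<close>

lemma lambert_term_abs_summable:
  assumes "\<And>x. x > 0 \<Longrightarrow> summable (\<lambda>n. lambert_term C x (Suc n))" and "x > 0"
  shows "summable (\<lambda>n. norm (lambert_term C x (Suc n)))"
proof -
  have "(\<lambda>n. lambert_term C (x/2) (Suc n)) \<longlonglongrightarrow> 0"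
    using assms by (intro summable_LIMSEQ_zero) auto
  then have "Bseq (\<lambda>n. lambert_term C (x/2) (Suc n))"
    by (intro convergent_imp_Bseq convergentI)
  then obtain M where M: "M > 0" "\<And>n. norm (lambert_term C (x/2) (Suc n)) \<le> M"
    unfolding Bseq_def by blast
  define r where "r = exp (- (x/2))"
  have r: "0 < r" "r < 1" using assms(2) by (auto simp: r_def)
  have "norm (lambert_term C x (Suc n)) \<le> M * r ^ Suc n" for n
  proof -
    \<comment> \<open>With this \<open>y\<close> the denominator at \<open>x\<close> is y^2 - 1 = (y
      - 1)(y + 1), while the one at \<open>x/2\<close> is y - 1. The terms thus differ by the factor
      1 / (y + 1), which is below 1 / y.\<close>
    define y where "y = exp (real (Suc n) * (x/2))"
    have y: "y > 1" using assms(2) by (simp add: y_def)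
    have y2: "exp (real (Suc n) * x) = y * y" by (simp add: y_def flip: exp_add)
    have "norm (complex_of_real y - 1) = y - 1"
      using y by (metis norm_of_real of_real_1 of_real_diff abs_of_pos diff_gt_0_iff_gt)
    moreover have "norm (complex_of_real (y * y) - 1) = (y - 1) * (y + 1)"
    proof -
      have "complex_of_real (y * y) - 1 = of_real ((y - 1) * (y + 1))"
        by (simp add: algebra_simps)
      then show ?thesis using y by (simp only: norm_of_real) simp
    qed
    ultimately have "norm (lambert_term C x (Suc n)) =
        norm (lambert_term C (x/2) (Suc n)) * (1 / (y + 1))"
      by (simp only: lambert_term_def y2 y_def[symmetric] norm_divide) simp
    also have "\<dots> \<le> M * (1 / y)"
      using M y by (intro mult_mono frac_le) auto
    also have "1 / y = r ^ Suc n"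
      unfolding y_def r_def exp_minus exp_of_nat_mult power_inverse by (rule inverse_eq_divide[symmetric])
    finally show ?thesis .
  qed
  then have bound: "norm (norm (lambert_term C x (Suc n))) \<le> M * r ^ Suc n" for n
    by simp
  have "summable (\<lambda>n. M * r ^ Suc n)"
    using r by (intro summable_mult) (simp add: summable_Suc_iff summable_geometric)
  then show ?thesis by (rule summable_comparison_test'[OF _ bound])
qed

text \<open>The sum is unordered, to allow rearranging a double series. The type is general because
  it serves for complex rows and for the real rows of their norms.\<close>

lemma geometric_has_sum_Suc:
  fixes z :: "'a :: {real_normed_field, banach}"
  assumes "norm z < 1"
  shows "((\<lambda>j. z ^ Suc j) has_sum (z / (1 - z))) UNIV"
proof (rule norm_summable_imp_has_sum)
  show "summable (\<lambda>j. norm (z ^ Suc j))"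
    using assms by (simp add: norm_mult norm_power summable_mult summable_geometric)
  show "(\<lambda>j. z ^ Suc j) sums (z / (1 - z))"
    using sums_mult[OF geometric_sums[OF assms], of z] by simp
qed

text \<open>Expand each Lambert term geometrically and collect the terms with equal exponent.\<close>

lemma lambert_series_sums:
  assumes "\<And>x. x > 0 \<Longrightarrow> summable (\<lambda>n. lambert_term C x (Suc n))" and "x > 0"
  shows "(\<lambda>n. exp_term (\<lambda>n. \<Sum>d | d dvd n. C d) x (Suc n))
    sums (\<Sum>n. lambert_term C x (Suc n))"
proof -
  define r where "r = exp (- x)"
  define q where "q = complex_of_real r"
  have r: "0 < r" "r < 1" using assms(2) by (auto simp: r_def)
  have q: "norm q = r" "q \<noteq> 0" using r by (auto simp: q_def)
  have rn: "r ^ Suc i < 1" for i using r by (intro power_less_one_iff[THEN iffD2]) auto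
  \<comment> \<open>Row \<open>i\<close> is the geometric expansion of the Lambert term of index
    \<open>Suc i\<close>. The powers start at 1 because 1 / (e^t - 1) = w / (1 - w) for w =
    e^(-t).\<close>
  define F where "F = (\<lambda>(i, j). C (Suc i) * (q ^ Suc i) ^ Suc j)"
  have lt: "lambert_term C x (Suc i) = C (Suc i) * (q ^ Suc i / (1 - q ^ Suc i))" for i
  proof -
    have "complex_of_real (exp (real (Suc i) * x)) = inverse (q ^ Suc i)"
      unfolding q_def r_def exp_minus exp_of_nat_mult by (simp add: power_inverse)
    moreover have "inverse w - 1 = (1 - w) / w" if "w \<noteq> 0" for w :: complex
      using that by (simp add: field_simps)
    ultimately show ?thesis using q(2)
      by (simp only: lambert_term_def power_not_zero not_False_eq_True divide_divide_eq_right times_divide_eq_right)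
  qed
  have row: "((\<lambda>j. F (i, j)) has_sum lambert_term C x (Suc i)) UNIV" for i
    unfolding lt F_def prod.case
    using q rn by (intro has_sum_cmult_right geometric_has_sum_Suc) (simp add: norm_power del: power_Suc)
  \<comment> \<open>As \<open>q\<close> is a positive real, norms keep the shape of the row sums:
    the norms in row \<open>i\<close> add up to the norm of its Lambert term. Absolute convergence
    of the Lambert series thus passes to the double family.\<close>
  have nlt: "norm (lambert_term C x (Suc i)) = norm (C (Suc i)) * (r ^ Suc i / (1 - r ^ Suc i))" for i
  proof -
    have "1 - q ^ Suc i = of_real (1 - r ^ Suc i)" by (simp add: q_def)
    then have "norm (1 - q ^ Suc i) = 1 - r ^ Suc i"
      using rn[of i] by (simp only: norm_of_real)
    then show ?thesis by (simp only: lt norm_mult norm_divide norm_power q)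
  qed
  have nrow: "((\<lambda>j. norm (F (i, j))) has_sum norm (lambert_term C x (Suc i))) UNIV" for i
    unfolding nlt F_def prod.case norm_mult norm_power q
    using r rn[of i] by (intro has_sum_cmult_right geometric_has_sum_Suc) (simp del: power_Suc)
  have "(\<lambda>i. norm (lambert_term C x (Suc i))) summable_on UNIV"
    using lambert_term_abs_summable[OF assms]
    by (intro norm_summable_imp_summable_on) simp
  then have "(\<lambda>p. norm (F p)) summable_on UNIV \<times> UNIV"
    by (intro summable_on_SigmaI[OF nrow]) auto
  then have "F summable_on UNIV \<times> UNIV"
    by (rule abs_summable_summable)
  moreover have "((\<lambda>i. lambert_term C x (Suc i)) has_sum (\<Sum>n. lambert_term C x (Suc n))) UNIV"
    using lambert_term_abs_summable[OF assms] assms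
    by (intro norm_summable_imp_has_sum) (auto intro: summable_sums)
  ultimately have "(F has_sum (\<Sum>n. lambert_term C x (Suc n))) (UNIV \<times> UNIV)"
    using row by (intro has_sum_SigmaI) auto
  \<comment> \<open>Sort by exponent: \<open>Suc n = Suc i * Suc j\<close> and
    \<open>d = Suc i\<close>. Conversely, a divisor \<open>d\<close> of \<open>Suc n\<close> gives
    \<open>i\<close>, and its cofactor is \<open>Suc j\<close>.\<close>
  also have "?this \<longleftrightarrow> ((\<lambda>(n, d). C d * q ^ Suc n) has_sum (\<Sum>n. lambert_term C x (Suc n)))
      (SIGMA n:UNIV. {d. d dvd Suc n})"
  proof (rule has_sum_reindex_bij_witness[where
        j = "\<lambda>(i, j). (Suc i * Suc j - 1, Suc i)" and i = "\<lambda>(n, d). (d - 1, Suc n div d - 1)"])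
    fix p :: "nat \<times> nat" assume "p \<in> (SIGMA n:UNIV. {d. d dvd Suc n})"
    then obtain n d where p: "p = (n, d)" "d dvd Suc n" by auto
    then obtain e where e: "Suc n = d * e" by blast
    then have "d > 0" "e > 0" by (auto intro: gr0I)
    then have "Suc (d - 1) * Suc (Suc n div d - 1) - 1 = n"
      by (simp add: e del: mult_Suc mult_Suc_right) (simp flip: e)
    with \<open>d > 0\<close> show "(case (case p of (n, d) \<Rightarrow> (d - 1, Suc n div d - 1)) of
        (i, j) \<Rightarrow> (Suc i * Suc j - 1, Suc i)) = p"
      by (simp add: p(1) del: mult_Suc mult_Suc_right)
  next
    fix p :: "nat \<times> nat"
    obtain i j where p: "p = (i, j)" by (cases p)
    have S: "Suc (Suc i * Suc j - 1) = Suc i * Suc j" by simp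
    show "(case (case p of (i, j) \<Rightarrow> (Suc i * Suc j - 1, Suc i)) of
        (n, d) \<Rightarrow> (d - 1, Suc n div d - 1)) = p"
      unfolding p prod.case S by (simp del: mult_Suc mult_Suc_right)
    show "(case p of (i, j) \<Rightarrow> (Suc i * Suc j - 1, Suc i)) \<in> (SIGMA n:UNIV. {d. d dvd Suc n})"
      unfolding p prod.case by (auto simp del: mult_Suc mult_Suc_right simp: S)
    show "(case (case p of (i, j) \<Rightarrow> (Suc i * Suc j - 1, Suc i)) of
        (n, d) \<Rightarrow> C d * q ^ Suc n) = F p"
      unfolding p prod.case S F_def power_mult ..
  qed auto
  \<comment> \<open>Each fibre is finite because \<open>Suc n\<close> is positive, so summing over
    \<open>d\<close> first yields finite divisor sums.\<close>
  finally have "((\<lambda>n. \<Sum>d | d dvd Suc n. C d * q ^ Suc n) has_sum (\<Sum>n. lambert_term C x (Suc n))) UNIV"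
    by (rule has_sum_Sigma') (auto intro!: has_sum_finiteI)
  then have "(\<lambda>n. \<Sum>d | d dvd Suc n. C d * q ^ Suc n) sums (\<Sum>n. lambert_term C x (Suc n))"
    by (rule has_sum_imp_sums)
  then show ?thesis
    by (simp only: exp_term_powser q_def r_def sum_distrib_right)
qed

section \<open>Linearity of the differential equation\<close>

text \<open>Induction on the order, one differentiation per step: differentiability below order
  \<open>N\<close> is what is needed to reach the values of order \<open>N\<close> itself.\<close>

lemma nth_deriv_diff:
  assumes "\<And>\<nu> x. \<nu> < N \<Longrightarrow> x > 0 \<Longrightarrow> nth_deriv \<nu> u differentiable (at x)"
    and "\<And>\<nu> x. \<nu> < N \<Longrightarrow> x > 0 \<Longrightarrow> nth_deriv \<nu> v differentiable (at x)"
    and "k \<le> N" and "x > 0"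
  shows "nth_deriv k (\<lambda>x. u x - v x) x = nth_deriv k u x - nth_deriv k v x"
    and "k < N \<Longrightarrow> nth_deriv k (\<lambda>x. u x - v x) differentiable (at x)"
proof -
  have step: "(nth_deriv k (\<lambda>x. u x - v x) has_vector_derivative
      nth_deriv (Suc k) u x - nth_deriv (Suc k) v x) (at x)"
    if "\<And>x. x > 0 \<Longrightarrow> nth_deriv k (\<lambda>x. u x - v x) x = nth_deriv k u x - nth_deriv k v x"
      "k < N" "x > 0" for k x
  proof (rule has_vector_derivative_transform_within_open[where S = "{0<..}"])
    show "((\<lambda>x. nth_deriv k u x - nth_deriv k v x) has_vector_derivative
        nth_deriv (Suc k) u x - nth_deriv (Suc k) v x) (at x)"
      using assms(1,2)[of k x] that unfolding nth_deriv_Suc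
      by (intro has_vector_derivative_diff) (simp_all add: vector_derivative_works)
  qed (use that in auto)
  have eq: "nth_deriv k (\<lambda>x. u x - v x) x = nth_deriv k u x - nth_deriv k v x"
    if "k \<le> N" "x > 0" for k x
    using that
  proof (induction k arbitrary: x)
    case (Suc k)
    then show ?case
      using vector_derivative_at[OF step[of k x]] by (simp add: nth_deriv_Suc)
  qed simp
  show "nth_deriv k (\<lambda>x. u x - v x) x = nth_deriv k u x - nth_deriv k v x"
    using eq assms(3,4) .
  show "nth_deriv k (\<lambda>x. u x - v x) differentiable (at x)" if "k < N"
    using step[OF eq that assms(4)] that by (intro differentiableI_vector) auto
qed

lemma solves_ode_diff:
  assumes "solves_ode a N f u" "solves_ode a N g v"
  shows "solves_ode a N (\<lambda>x. f x - g x) (\<lambda>x. u x - v x)"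
proof -
  have d: "\<And>\<nu> x. \<nu> < N \<Longrightarrow> x > 0 \<Longrightarrow> nth_deriv \<nu> u differentiable (at x)"
    "\<And>\<nu> x. \<nu> < N \<Longrightarrow> x > 0 \<Longrightarrow> nth_deriv \<nu> v differentiable (at x)"
    using assms by (auto simp: solves_ode_def)
  have "(\<Sum>\<nu>\<le>N. a \<nu> * nth_deriv \<nu> (\<lambda>x. u x - v x) x) = f x - g x" if "x > 0" for x
  proof -
    have "(\<Sum>\<nu>\<le>N. a \<nu> * nth_deriv \<nu> (\<lambda>x. u x - v x) x)
        = (\<Sum>\<nu>\<le>N. a \<nu> * nth_deriv \<nu> u x - a \<nu> * nth_deriv \<nu> v x)"
      using that by (intro sum.cong refl) (simp add: nth_deriv_diff(1)[OF d] right_diff_distrib)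
    also have "\<dots> = f x - g x"
      using assms that by (simp add: sum_subtractf solves_ode_def)
    finally show ?thesis .
  qed
  then show ?thesis
    using nth_deriv_diff(2)[OF d] by (simp add: solves_ode_def)
qed

section \<open>Solution formula\<close>

text \<open>The equation fixes a solution only up to solutions of the homogeneous equation. Equality
  with \<open>u0\<close> is therefore claimed for solutions that are themselves exponential
  series.\<close>

theorem theorem1:
  fixes a C :: "nat \<Rightarrow> complex" and N :: nat
  defines "f \<equiv> (\<lambda>x. \<Sum>n. lambert_term C x (Suc n))"
    and "u0 \<equiv> (\<lambda>x. \<Sum>n. exp_term (sol_coeff a N C) x (Suc n))"
  assumes "\<And>n. n \<ge> 1 \<Longrightarrow> char_fun a N (- of_nat n) \<noteq> 0"
    and "\<And>x. x > 0 \<Longrightarrow> summable (\<lambda>n. lambert_term C x (Suc n))"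
  shows "(\<forall>x>0. summable (\<lambda>n. exp_term (sol_coeff a N C) x (Suc n))) \<and>
    solves_ode a N f u0 \<and>
    (\<forall>u. solves_ode a N f u \<longrightarrow>
       (\<exists>h. solves_ode a N (\<lambda>_. 0) h \<and> (\<forall>x>0. u x = u0 x + h x))) \<and>
    (\<forall>u b. solves_ode a N f u \<and> (\<forall>x>0. (\<lambda>n. exp_term b x (Suc n)) sums u x) \<longrightarrow>
       (\<forall>x>0. u x = u0 x))"
proof -
  define D where "D n = (\<Sum>d | d dvd n. C d)" for n
  have D: "(\<lambda>n. exp_term D x (Suc n)) sums f x" if "x > 0" for x
    using lambert_series_sums[OF assms(4) that] by (simp add: D_def[abs_def] f_def)
  have P_sol: "char_fun a N (- of_nat (Suc n)) * sol_coeff a N C (Suc n) = D (Suc n)" for n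
    using assms(3)[of "Suc n"] by (simp add: sol_coeff_def D_def)
  obtain K where K: "\<And>n. n \<ge> 1 \<Longrightarrow> norm (inverse (char_fun a N (- of_nat n))) \<le> K"
    using char_fun_inverse_bounded[OF assms(3)] by blast
  have sm: "summable (\<lambda>n. exp_term (sol_coeff a N C) x (Suc n))" if "x > 0" for x
  proof (rule summable_comparison_test)
    \<comment> \<open>The majorant is \<open>K\<close> times the series of divisor sums, which
      converges absolutely because it converges for every positive argument.\<close>
    have "summable (\<lambda>n. norm ((D(0 := 0)) n * complex_of_real (exp (- x)) ^ n))"
      using D that by (intro summable_norm_disc) (auto intro: sums_summable)
    then have "summable (\<lambda>n. norm ((D(0 := 0)) (Suc n) * complex_of_real (exp (- x)) ^ Suc n))"
      by (subst summable_Suc_iff)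
    then show "summable (\<lambda>n. K * norm (exp_term D x (Suc n)))"
      by (intro summable_mult) (simp add: exp_term_powser)
    have "norm (exp_term (sol_coeff a N C) x (Suc n)) \<le> K * norm (exp_term D x (Suc n))" for n
    proof -
      have "exp_term (sol_coeff a N C) x (Suc n)
          = inverse (char_fun a N (- of_nat (Suc n))) * exp_term D x (Suc n)"
        by (simp add: exp_term_def sol_coeff_def D_def divide_inverse)
      then show ?thesis
        using K[of "Suc n"] by (simp only: norm_mult) (simp add: mult_right_mono)
    qed
    then show "\<exists>M. \<forall>n\<ge>M. norm (exp_term (sol_coeff a N C) x (Suc n))
        \<le> K * norm (exp_term D x (Suc n))" by blast
  qed
  have u0: "\<And>x. x > 0 \<Longrightarrow> u0 x = (\<Sum>n. exp_term (sol_coeff a N C) x (Suc n))"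
    by (simp add: u0_def)
  have "(\<Sum>\<nu>\<le>N. a \<nu> * nth_deriv \<nu> u0 x) = f x" if "x > 0" for x
  proof (rule sums_unique2)
    show "(\<lambda>n. exp_term (\<lambda>n. char_fun a N (- of_nat n) * sol_coeff a N C n) x (Suc n))
        sums (\<Sum>\<nu>\<le>N. a \<nu> * nth_deriv \<nu> u0 x)"
      by (rule ode_operator_exp_series[OF sm u0 that])
    show "(\<lambda>n. exp_term (\<lambda>n. char_fun a N (- of_nat n) * sol_coeff a N C n) x (Suc n)) sums f x"
      using D[OF that] by (simp only: exp_term_def P_sol)
  qed
  then have ode: "solves_ode a N f u0"
    using nth_deriv_exp_series(3)[OF sm u0] by (simp add: solves_ode_def)
  have hom: "\<exists>h. solves_ode a N (\<lambda>_. 0) h \<and> (\<forall>x>0. u x = u0 x + h x)" if "solves_ode a N f u" for u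
    using solves_ode_diff[OF that ode] by (intro exI[of _ "\<lambda>x. u x - u0 x"]) simp
  have uniq: "u x = u0 x"
    if u: "solves_ode a N f u" and b: "\<And>x. x > 0 \<Longrightarrow> (\<lambda>n. exp_term b x (Suc n)) sums u x"
      and "x > 0" for u b x
  proof -
    \<comment> \<open>The operator turns the expansion of \<open>u\<close> into one of
      \<open>f\<close>. Coefficient uniqueness then equates
      \<open>char_fun a N (- of_nat n) * b n\<close> with the divisor sum, and the nonzero factor
      cancels.\<close>
    have "(\<lambda>n. exp_term (\<lambda>n. char_fun a N (- of_nat n) * b n) x (Suc n)) sums f x" if "x > 0" for x
      using ode_operator_exp_series[of b u x a N] b u that
      by (auto simp: sums_iff solves_ode_def)
    then have "char_fun a N (- of_nat (Suc n)) * b (Suc n) = D (Suc n)" for n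
      using exp_series_coeff_unique[OF _ D] by blast
    then have "b (Suc n) = sol_coeff a N C (Suc n)" for n
      using P_sol[of n] assms(3)[of "Suc n"] by (metis le_add1 mult_left_cancel plus_1_eq_Suc)
    then have "exp_term b x (Suc n) = exp_term (sol_coeff a N C) x (Suc n)" for n
      by (simp only: exp_term_def)
    then show ?thesis
      using b[OF \<open>x > 0\<close>] by (simp add: u0_def sums_iff)
  qed
  show ?thesis using sm ode hom uniq by blast
qed

end
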